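(* Let $k\in\mathbb N$, $f\in\mathcal R^k_{[1]}(\mathbb R^2)$ and $h\in\mathcal R^{k+1}_{[1]}(\mathbb R^2)$ such that $\mathrm{pol}(f)\subseteq\mathcal Z(h)$. Then $hf\in\mathcal R^{k+1}_{[1]}(\mathbb R^2)$.
   Context: For $k\in\mathbb N\cup\{\infty\}$, $\mathcal R^k(\mathbb R^2)$ denotes the ring of functions $f:\mathbb R^2\to\mathbb R$ of class $C^k$ that coincide with $p/q$ ($p,q$ polynomials, $q$ nonvanishing there) on some nonempty Zariski open set; $\mathrm{dom}(f)$ is the largest Zariski open set on which the associated rational function is regular and $\mathrm{pol}(f)=\mathbb R^2\setminus\mathrm{dom}(f)$. $\mathcal Z(h)$ is the zero set of $h$. For $l\in\mathbb N$: consider compositions $\pi:M\to\mathbb R^2$ of successive blowings-up $M_i\to M_{i-1}$ ($M_0=\mathbb R^2$), each centred at points. An infinitely near point of order $j$ is a sequence $a_0\in M_0,\dots,a_j\in M_j$ where $M_i$ is the blowing-up of $M_{i-1}$ at $a_{i-1}$ and $a_i$ maps to $a_{i-1}$; the number of stages of $\pi$ is the maximal order of infinitely near points in $M$. $\mathcal R^k_{[l]}(\mathbb R^2)$ is the set of $f\in\mathcal R^k(\mathbb R^2)$ for which there is such a $\pi$ with at most $l$ stages such that $f\circ\pi$ is regular on $M$. *)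

theory Defs
  imports "HOL-Analysis.Analysis"
begin

definition is_poly2 :: "(real \<times> real \<Rightarrow> real) \<Rightarrow> bool" where
  "is_poly2 p \<longleftrightarrow> (\<exists>(c :: nat \<Rightarrow> nat \<Rightarrow> real) N.
      p = (\<lambda>z. \<Sum>i\<le>N. \<Sum>j\<le>N. c i j * fst z ^ i * snd z ^ j))"

definition zariski_closed :: "(real \<times> real) set \<Rightarrow> bool" where
  "zariski_closed C \<longleftrightarrow> (\<exists>P. (\<forall>p\<in>P. is_poly2 p) \<and> C = {z. \<forall>p\<in>P. p z = 0})"

definition zariski_open :: "(real \<times> real) set \<Rightarrow> bool" where
  "zariski_open U \<longleftrightarrow> zariski_closed (- U)"

fun Ck :: "nat \<Rightarrow> (real \<times> real \<Rightarrow> real) \<Rightarrow> bool" where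
  "Ck 0 f = continuous_on UNIV f"
| "Ck (Suc k) f = (\<exists>f1 f2. (\<forall>z. (f has_derivative (\<lambda>w. f1 z * fst w + f2 z * snd w)) (at z))
                      \<and> Ck k f1 \<and> Ck k f2)"

definition regulous :: "nat \<Rightarrow> (real \<times> real \<Rightarrow> real) \<Rightarrow> bool" where
  "regulous k f \<longleftrightarrow> Ck k f \<and>
     (\<exists>p q U. is_poly2 p \<and> is_poly2 q \<and> zariski_open U \<and> U \<noteq> {} \<and>
        (\<forall>z\<in>U. q z \<noteq> 0 \<and> f z = p z / q z))"

text \<open>The rational function associated with f is regular at a: it can be written p/q
  with q(a) nonzero (equality as rational functions, i.e. on a nonempty Zariski open set).\<close>

definition rat_regular_at :: "(real \<times> real \<Rightarrow> real) \<Rightarrow> real \<times> real \<Rightarrow> bool" where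
  "rat_regular_at f a \<longleftrightarrow> (\<exists>p q U. is_poly2 p \<and> is_poly2 q \<and> q a \<noteq> 0 \<and>
      zariski_open U \<and> U \<noteq> {} \<and> (\<forall>z\<in>U. q z \<noteq> 0 \<and> f z = p z / q z))"

definition dom_reg :: "(real \<times> real \<Rightarrow> real) \<Rightarrow> (real \<times> real) set" where
  "dom_reg f = {a. rat_regular_at f a}"

definition pol :: "(real \<times> real \<Rightarrow> real) \<Rightarrow> (real \<times> real) set" where
  "pol f = UNIV - dom_reg f"

definition regular_at :: "(real \<times> real \<Rightarrow> real) \<Rightarrow> real \<times> real \<Rightarrow> bool" where
  "regular_at g z \<longleftrightarrow> (\<exists>p q U. is_poly2 p \<and> is_poly2 q \<and> zariski_open U \<and> z \<in> U \<and>
      (\<forall>w\<in>U. q w \<noteq> 0 \<and> g w = p w / q w))"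

text \<open>The two standard affine charts of the blowing-up of the plane at a point a;
  the exceptional divisor is {u = 0} in the first chart and {v = 0} in the second.\<close>

definition blowup_chart1 :: "real \<times> real \<Rightarrow> real \<times> real \<Rightarrow> real \<times> real" where
  "blowup_chart1 a w = (fst a + fst w, snd a + fst w * snd w)"

definition blowup_chart2 :: "real \<times> real \<Rightarrow> real \<times> real \<Rightarrow> real \<times> real" where
  "blowup_chart2 a w = (fst a + fst w * snd w, snd a + snd w)"

text \<open>A composition of blowings-up with at most one stage is the blowing-up of a finite
  set S of points of the plane (S empty: zero stages).  f composed with it is regular on
  the blown-up surface iff f is regular at every point outside S and, for each centre a in S,
  f composed with the charts is regular along the exceptional divisor over a.\<close>

definition regular_after_blowup :: "(real \<times> real \<Rightarrow> real) \<Rightarrow> (real \<times> real) set \<Rightarrow> bool" where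
  "regular_after_blowup f S \<longleftrightarrow> finite S \<and>
     (\<forall>z. z \<notin> S \<longrightarrow> regular_at f z) \<and>
     (\<forall>a\<in>S. \<forall>t. regular_at (f \<circ> blowup_chart1 a) (0, t) \<and>
                 regular_at (f \<circ> blowup_chart2 a) (t, 0))"

definition regulous_1 :: "nat \<Rightarrow> (real \<times> real \<Rightarrow> real) \<Rightarrow> bool" where
  "regulous_1 k f \<longleftrightarrow> regulous k f \<and> (\<exists>S. regular_after_blowup f S)"

end

theory Submission
  imports Defs
begin

text \<open>
  The only difficulty is that \<open>h f\<close> is of class \<open>C\<^sup>k\<^sup>+\<^sup>1\<close> at the finitely many poles of f, all of
  which are zeros of h. By induction on k, writing \<open>(h f)\<^sub>x = h\<^sub>x f + h f\<^sub>x\<close>: the first summand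
  is of class \<open>C\<^sup>k\<close>, and for \<open>k > 0\<close> the second one is by the induction hypothesis, because a
  partial derivative of f is again regular after blowing up its poles. For \<open>k = 0\<close> the
  derivative of \<open>h f\<close> at a pole a is \<open>f(a) h'(a)\<close>, and \<open>h f\<^sub>x\<close> tends to 0 there since \<open>f\<^sub>x\<close> extends to
  a regular function along the compact exceptional divisor and hence is bounded.
\<close>

section \<open>Polynomial functions in two variables\<close>

lemma is_poly2_monomial: "is_poly2 (\<lambda>z. c * fst z ^ m * snd z ^ n)"
proof -
  \<comment> \<open>The square index range needs one bound for both exponents; \<open>m+n\<close> is
    at least each of them.\<close>
  define d where "d = (\<lambda>i j. if i = m \<and> j = n then c else (0::real))"
  have "(\<Sum>i\<le>m+n. \<Sum>j\<le>m+n. d i j * fst z ^ i * snd z ^ j) = c * fst z ^ m * snd z ^ n"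
    for z :: "real \<times> real"
  proof -
    have "(\<Sum>j\<le>m+n. d i j * fst z ^ i * snd z ^ j)
        = (if i = m then c * fst z ^ m * snd z ^ n else 0)" for i
    proof -
      have "(\<Sum>j\<le>m+n. d i j * fst z ^ i * snd z ^ j)
          = (\<Sum>j\<le>m+n. if j = n then (if i = m then c * fst z ^ m * snd z ^ n else 0) else 0)"
        by (rule sum.cong) (auto simp: d_def)
      then show ?thesis by simp
    qed
    then show ?thesis by simp
  qed
  then show ?thesis unfolding is_poly2_def by (intro exI[of _ d] exI[of _ "m+n"]) auto
qed

lemma is_poly2_add:
  assumes "is_poly2 p" "is_poly2 q"
  shows "is_poly2 (\<lambda>z. p z + q z)"
proof -
  \<comment> \<open>Padding with zero coefficients brings two coefficient squares of different sizes
    to a common one, where they can be added entrywise.\<close>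
  have extend: "(\<Sum>i\<le>N. \<Sum>j\<le>N. c i j * fst z ^ i * snd z ^ j)
      = (\<Sum>i\<le>M. \<Sum>j\<le>M. (if i \<le> N \<and> j \<le> N then c i j else 0) * fst z ^ i * snd z ^ j)"
    if "N \<le> M" for N M and c :: "nat \<Rightarrow> nat \<Rightarrow> real" and z :: "real \<times> real"
  proof (rule sum.mono_neutral_cong_left)
    fix i assume "i \<in> {..N}"
    then show "(\<Sum>j\<le>N. c i j * fst z ^ i * snd z ^ j)
      = (\<Sum>j\<le>M. (if i \<le> N \<and> j \<le> N then c i j else 0) * fst z ^ i * snd z ^ j)"
      using that by (intro sum.mono_neutral_cong_left) auto
  qed (use that in auto)
  obtain c N where p: "p = (\<lambda>z. \<Sum>i\<le>N. \<Sum>j\<le>N. c i j * fst z ^ i * snd z ^ j)"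
    using assms(1) unfolding is_poly2_def by blast
  obtain d L where q: "q = (\<lambda>z. \<Sum>i\<le>L. \<Sum>j\<le>L. d i j * fst z ^ i * snd z ^ j)"
    using assms(2) unfolding is_poly2_def by blast
  define M where "M = max N L"
  have "p z + q z = (\<Sum>i\<le>M. \<Sum>j\<le>M. ((if i \<le> N \<and> j \<le> N then c i j else 0)
       + (if i \<le> L \<and> j \<le> L then d i j else 0)) * fst z ^ i * snd z ^ j)" for z
    unfolding p q extend[of N M, OF max.cobounded1[of N L, folded M_def]]
      extend[of L M, OF max.cobounded2[of L N, folded M_def]]
    by (simp only: sum.distrib[symmetric] distrib_right)
  then show ?thesis unfolding is_poly2_def
    by (intro exI[of _ "\<lambda>i j. (if i \<le> N \<and> j \<le> N then c i j else 0)
       + (if i \<le> L \<and> j \<le> L then d i j else 0)"] exI[of _ M]) auto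
qed

text \<open>The double sum is built up one monomial at a time. The empty sum is covered as well,
  being the monomial with coefficient 0.\<close>

lemma is_poly2_monomial_induct [consumes 1, case_names monomial add]:
  assumes "is_poly2 p"
    and "\<And>c m n. P (\<lambda>z. c * fst z ^ m * snd z ^ n)"
    and add: "\<And>p q. P p \<Longrightarrow> P q \<Longrightarrow> P (\<lambda>z. p z + q z)"
  shows "P p"
proof -
  have sum: "P (\<lambda>z. \<Sum>i\<in>A. r i z)"
    if "finite A" "\<And>i. i \<in> A \<Longrightarrow> P (r i)" for A :: "nat set" and r
    using that
  proof (induction A rule: finite_induct)
    case empty
    then show ?case using assms(2)[of 0 0 0] by simp
  next
    case (insert x A)
    then show ?case using add[of "r x" "\<lambda>z. \<Sum>i\<in>A. r i z"] by simp
  qed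
  obtain c N where p: "p = (\<lambda>z. \<Sum>i\<le>N. \<Sum>j\<le>N. c i j * fst z ^ i * snd z ^ j)"
    using assms(1) unfolding is_poly2_def by blast
  show ?thesis unfolding p by (intro sum assms(2)) auto
qed

lemma is_poly2_const: "is_poly2 (\<lambda>z. c)"
  using is_poly2_monomial[of c 0 0] by simp

lemma is_poly2_fst: "is_poly2 fst"
  using is_poly2_monomial[of 1 1 0] by simp

lemma is_poly2_snd: "is_poly2 snd"
  using is_poly2_monomial[of 1 0 1] by simp

lemma is_poly2_mult:
  assumes "is_poly2 p" "is_poly2 q"
  shows "is_poly2 (\<lambda>z. p z * q z)"
  using assms(1)
proof (induction rule: is_poly2_monomial_induct)
  case (monomial c m n)
  show ?case using assms(2)
  proof (induction rule: is_poly2_monomial_induct)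
    case (monomial d k l)
    show ?case using is_poly2_monomial[of "c * d" "m + k" "n + l"]
      by (simp add: power_add algebra_simps)
  next
    case (add p q)
    then show ?case using is_poly2_add[OF add] by (simp add: distrib_left)
  qed
next
  case (add p q)
  then show ?case using is_poly2_add[OF add] by (simp add: distrib_right)
qed

lemma is_poly2_diff:
  assumes "is_poly2 p" "is_poly2 q"
  shows "is_poly2 (\<lambda>z. p z - q z)"
  using is_poly2_add[OF assms(1) is_poly2_mult[OF is_poly2_const[of "-1"] assms(2)]] by simp

lemma is_poly2_power: "is_poly2 p \<Longrightarrow> is_poly2 (\<lambda>z. p z ^ n)"
  by (induction n) (auto intro: is_poly2_const is_poly2_mult)

lemmas is_poly2_intros = is_poly2_power
  is_poly2_const is_poly2_fst is_poly2_snd is_poly2_add is_poly2_mult is_poly2_diff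

text \<open>Monomials are products of constants and coordinates, so any property stable under ring
  operations spreads from these generators. This form suits substitution, continuity,
  differentiation and restriction to lines.\<close>

lemma is_poly2_induct [consumes 1, case_names const fst snd add mult]:
  assumes "is_poly2 p"
    and "\<And>c. P (\<lambda>z. c)" "P fst" "P snd"
    and "\<And>p q. P p \<Longrightarrow> P q \<Longrightarrow> P (\<lambda>z. p z + q z)"
    and mult: "\<And>p q. P p \<Longrightarrow> P q \<Longrightarrow> P (\<lambda>z. p z * q z)"
  shows "P p"
proof -
  have power: "P (\<lambda>z. r z ^ n)" if "P r" for r n
    by (induction n) (use assms(2)[of 1] mult[OF that] in auto)
  show ?thesis using assms(1)
    by (induction rule: is_poly2_monomial_induct) (intro assms power; assumption?)+
qed

lemma is_poly2_compose:
  assumes "is_poly2 p" "is_poly2 \<alpha>" "is_poly2 \<beta>"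
  shows "is_poly2 (\<lambda>z. p (\<alpha> z, \<beta> z))"
  using assms(1) by (induction rule: is_poly2_induct) (auto intro: is_poly2_intros assms)

lemma is_poly2_chart1: "is_poly2 p \<Longrightarrow> is_poly2 (p \<circ> blowup_chart1 a)"
  unfolding blowup_chart1_def comp_def by (erule is_poly2_compose) (intro is_poly2_intros)+

lemma is_poly2_chart2: "is_poly2 p \<Longrightarrow> is_poly2 (p \<circ> blowup_chart2 a)"
  unfolding blowup_chart2_def comp_def by (erule is_poly2_compose) (intro is_poly2_intros)+

lemma is_poly2_swap: "is_poly2 p \<Longrightarrow> is_poly2 (\<lambda>z. p (prod.swap z))"
  unfolding prod.swap_def by (erule is_poly2_compose) (intro is_poly2_intros)+

section \<open>Derivatives and continuity of polynomial functions\<close>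

lemma has_derivative_mult_partials:
  fixes f g :: "real \<times> real \<Rightarrow> real"
  assumes "(f has_derivative (\<lambda>w. f1 * fst w + f2 * snd w)) (at z)"
    and "(g has_derivative (\<lambda>w. g1 * fst w + g2 * snd w)) (at z)"
  shows "((\<lambda>z. f z * g z) has_derivative
    (\<lambda>w. (f1 * g z + f z * g1) * fst w + (f2 * g z + f z * g2) * snd w)) (at z)"
  using has_derivative_mult[OF assms] by (simp add: algebra_simps)

lemma is_poly2_has_derivative:
  assumes "is_poly2 p"
  obtains p1 p2 where "is_poly2 p1" "is_poly2 p2"
    "\<And>z. (p has_derivative (\<lambda>w. p1 z * fst w + p2 z * snd w)) (at z)"
proof -
  \<comment> \<open>The conjunct \<open>is_poly2 p\<close> strengthens the induction: the product
    rule puts the factors themselves into the partials, and their polynomiality has to come from the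
    induction hypothesis.\<close>
  have "is_poly2 p \<and> (\<exists>p1 p2. is_poly2 p1 \<and> is_poly2 p2 \<and>
    (\<forall>z. (p has_derivative (\<lambda>w. p1 z * fst w + p2 z * snd w)) (at z)))"
    using assms
  proof (induction rule: is_poly2_induct)
    case (const c)
    show ?case by (intro conjI exI[of _ "\<lambda>z. 0"]) (auto intro: is_poly2_intros)
  next
    case fst
    show ?case
      by (intro conjI exI[of _ "\<lambda>z. 1"] exI[of _ "\<lambda>z. 0"])
        (auto intro!: is_poly2_intros derivative_eq_intros)
  next
    case snd
    show ?case
      by (intro conjI exI[of _ "\<lambda>z. 0"] exI[of _ "\<lambda>z. 1"])
        (auto intro!: is_poly2_intros derivative_eq_intros)
  next
    case (add p q)
    then obtain p1 p2 q1 q2 where "is_poly2 p" "is_poly2 q"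
      and poly: "is_poly2 p1" "is_poly2 p2" "is_poly2 q1" "is_poly2 q2"
      and p: "\<And>z. (p has_derivative (\<lambda>w. p1 z * fst w + p2 z * snd w)) (at z)"
      and q: "\<And>z. (q has_derivative (\<lambda>w. q1 z * fst w + q2 z * snd w)) (at z)" by blast
    then show ?case
      using has_derivative_add[OF p q]
      by (intro conjI exI[of _ "\<lambda>z. p1 z + q1 z"] exI[of _ "\<lambda>z. p2 z + q2 z"])
        (auto intro!: is_poly2_intros simp: algebra_simps)
  next
    case (mult p q)
    then obtain p1 p2 q1 q2 where "is_poly2 p" "is_poly2 q"
      and poly: "is_poly2 p1" "is_poly2 p2" "is_poly2 q1" "is_poly2 q2"
      and p: "\<And>z. (p has_derivative (\<lambda>w. p1 z * fst w + p2 z * snd w)) (at z)"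
      and q: "\<And>z. (q has_derivative (\<lambda>w. q1 z * fst w + q2 z * snd w)) (at z)" by blast
    then show ?case
      using has_derivative_mult_partials[OF p q]
      by (intro conjI exI[of _ "\<lambda>z. p1 z * q z + p z * q1 z"] exI[of _ "\<lambda>z. p2 z * q z + p z * q2 z"])
        (auto intro!: is_poly2_intros)
  qed
  then show ?thesis using that by blast
qed

lemma is_poly2_continuous_on: "is_poly2 p \<Longrightarrow> continuous_on A p"
  by (induction rule: is_poly2_induct) (auto intro!: continuous_intros)

lemma is_poly2_isCont: "is_poly2 p \<Longrightarrow> isCont p z"
  using is_poly2_continuous_on[of p UNIV] by (metis UNIV_I continuous_on_eq_continuous_at open_UNIV)

lemma is_poly2_eventually_nonzero:
  assumes "is_poly2 p" "p z \<noteq> 0"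
  shows "\<forall>\<^sub>F w in nhds z. p w \<noteq> 0"
proof -
  have "(p \<longlongrightarrow> p z) (nhds z)"
    using is_poly2_isCont[OF assms(1)] by (simp add: isCont_def tendsto_nhds_iff)
  then show ?thesis using tendsto_imp_eventually_ne assms(2) by blast
qed

section \<open>Identity principle and division by a coordinate\<close>

lemma is_poly2_line:
  assumes "is_poly2 p"
  shows "\<exists>P. \<forall>s. p (z + s *\<^sub>R d) = poly P s"
  using assms
proof (induction rule: is_poly2_induct)
  case (const c)
  show ?case by (rule exI[of _ "[:c:]"]) simp
next
  case fst
  show ?case by (rule exI[of _ "[:fst z, fst d:]"]) simp
next
  case snd
  show ?case by (rule exI[of _ "[:snd z, snd d:]"]) simp
next
  case (add p q)
  then obtain P Q where "\<forall>s. p (z + s *\<^sub>R d) = poly P s" "\<forall>s. q (z + s *\<^sub>R d) = poly Q s"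
    by blast
  then show ?case by (intro exI[of _ "P + Q"]) simp
next
  case (mult p q)
  then obtain P Q where "\<forall>s. p (z + s *\<^sub>R d) = poly P s" "\<forall>s. q (z + s *\<^sub>R d) = poly Q s"
    by blast
  then show ?case by (intro exI[of _ "P * Q"]) simp
qed

text \<open>The restriction to a line is a univariate polynomial. Vanishing on an interval gives it
  infinitely many roots, so it is the zero polynomial.\<close>

lemma is_poly2_zero_on_line:
  assumes "is_poly2 p" and "\<forall>\<^sub>F s in nhds 0. p (z + s *\<^sub>R d) = 0"
  shows "p (z + s *\<^sub>R d) = 0"
proof -
  obtain P where P: "\<And>s. p (z + s *\<^sub>R d) = poly P s" using is_poly2_line[OF assms(1)] by blast
  obtain e where e: "e > 0" "\<And>s. \<bar>s\<bar> < e \<Longrightarrow> poly P s = 0"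
    using assms(2) unfolding P eventually_nhds_metric by auto
  have "infinite {0<..<e}" using e(1) by simp
  moreover have "{0<..<e} \<subseteq> {s. poly P s = 0}" using e(2) by auto
  ultimately have "infinite {s. poly P s = 0}" using finite_subset by blast
  then have "P = 0" using poly_roots_finite by blast
  then show ?thesis using P by simp
qed

text \<open>Every point \<open>w\<close> is reached from \<open>z\<close> by a line, at parameter 1,
  and the polynomial vanishes on that line for parameters near 0.\<close>

lemma is_poly2_zero_locally:
  assumes "is_poly2 p" and "\<forall>\<^sub>F w in nhds z. p w = 0"
  shows "p w = 0"
proof -
  have "((\<lambda>s. z + s *\<^sub>R (w - z)) \<longlongrightarrow> z + 0 *\<^sub>R (w - z)) (nhds 0)"
    by (intro tendsto_intros filterlim_ident)
  then have "filterlim (\<lambda>s. z + s *\<^sub>R (w - z)) (nhds z) (nhds (0::real))" by simp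
  then have "\<forall>\<^sub>F s in nhds 0. p (z + s *\<^sub>R (w - z)) = 0"
    by (rule eventually_compose_filterlim[OF assms(2)])
  from is_poly2_zero_on_line[OF assms(1) this, of 1] show ?thesis by simp
qed

text \<open>Modulo the first coordinate, \<open>p\<close> equals its restriction to the line where
  this coordinate is 0. A restriction that vanishes locally vanishes on the whole line, so the
  coordinate divides \<open>p\<close>. In a chart this splits off the equation of the exceptional
  divisor.\<close>

lemma is_poly2_factor_fst:
  assumes p: "is_poly2 p" and zero: "\<forall>\<^sub>F v in nhds t. p (0, v) = 0"
  obtains q where "is_poly2 q" "\<And>z. p z = fst z * q z"
proof -
  have "\<exists>q. is_poly2 q \<and> (\<forall>z. p z = p (0, snd z) + fst z * q z)"
    using p
  proof (induction rule: is_poly2_monomial_induct)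
    case (monomial c m n)
    show ?case
    proof (cases m)
      case 0
      then show ?thesis by (intro exI[of _ "\<lambda>z. 0"]) (auto intro: is_poly2_intros)
    next
      case (Suc l)
      then show ?thesis
        by (intro exI[of _ "\<lambda>z. c * fst z ^ l * snd z ^ n"]) (auto intro: is_poly2_monomial)
    qed
  next
    case (add p q)
    then obtain p' q' where poly: "is_poly2 p'" "is_poly2 q'"
      and p: "\<And>z. p z = p (0, snd z) + fst z * p' z"
      and q: "\<And>z. q z = q (0, snd z) + fst z * q' z" by blast
    have "p z + q z = p (0, snd z) + q (0, snd z) + fst z * (p' z + q' z)" for z
      using p[of z] q[of z] unfolding distrib_left by linarith
    then show ?case using is_poly2_add[OF poly] by blast
  qed
  then obtain q where q: "is_poly2 q" "\<And>z. p z = p (0, snd z) + fst z * q z" by blast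
  \<comment> \<open>Translation by \<open>t\<close> turns vanishing near \<open>(0, t)\<close> into
    vanishing near parameter 0 of the line through that point with direction
    \<open>(0, 1)\<close>.\<close>
  have "filterlim (\<lambda>s. t + s) (nhds (t + 0)) (nhds (0::real))"
    by (intro tendsto_intros filterlim_ident)
  then have "\<forall>\<^sub>F s in nhds 0. p (0, t + s) = 0"
    using eventually_compose_filterlim[OF zero] by simp
  then have "\<forall>\<^sub>F s in nhds 0. p ((0, t) + s *\<^sub>R (0, 1)) = 0" by simp
  from is_poly2_zero_on_line[OF p this] have "p (0, t + s) = 0" for s by simp
  from this[of "_ - t"] have "p (0, v) = 0" for v by simp
  then have "p z = fst z * q z" for z using q(2)[of z] by simp
  then show ?thesis using that q(1) by blast
qed

section \<open>Zariski open sets\<close>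

lemma zariski_open_nonzero: "is_poly2 r \<Longrightarrow> zariski_open {z. r z \<noteq> 0}"
  unfolding zariski_open_def zariski_closed_def by (rule exI[of _ "{r}"]) auto

text \<open>Some defining equation of the complement fails at \<open>z\<close>. The nonvanishing set
  of this single polynomial is then a basic open neighbourhood, so Zariski open sets can be handled
  through one polynomial each.\<close>

lemma zariski_openE:
  assumes "zariski_open U" "z \<in> U"
  obtains r where "is_poly2 r" "r z \<noteq> 0" "\<And>w. r w \<noteq> 0 \<Longrightarrow> w \<in> U"
proof -
  obtain P where P: "\<forall>p\<in>P. is_poly2 p" "- U = {z. \<forall>p\<in>P. p z = 0}"
    using assms(1) unfolding zariski_open_def zariski_closed_def by blast
  then obtain r where "r \<in> P" "r z \<noteq> 0" using assms(2) by blast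
  then show ?thesis using that[of r] P by blast
qed

text \<open>This is the irreducibility of the plane: otherwise \<open>q\<close> would vanish on the
  Euclidean neighbourhood of \<open>a\<close> where \<open>p\<close> is nonzero, hence
  everywhere.\<close>

lemma is_poly2_common_nonzero:
  assumes "is_poly2 p" "p a \<noteq> 0" "is_poly2 q" "q b \<noteq> 0"
  obtains z where "p z \<noteq> 0" "q z \<noteq> 0"
proof -
  have "\<exists>z. p z \<noteq> 0 \<and> q z \<noteq> 0"
  proof (rule ccontr)
    assume "\<nexists>z. p z \<noteq> 0 \<and> q z \<noteq> 0"
    then have "q w = 0" if "p w \<noteq> 0" for w using that by blast
    then have "\<forall>\<^sub>F w in nhds a. q w = 0"
      by (rule eventually_mono[OF is_poly2_eventually_nonzero[OF assms(1,2)]])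
    then show False using is_poly2_zero_locally assms(3,4) by blast
  qed
  then show ?thesis using that by blast
qed

section \<open>Regularity at a point and after blowing up\<close>

lemma regular_atE:
  assumes "regular_at g z"
  obtains p q r where "is_poly2 p" "is_poly2 q" "is_poly2 r" "r z \<noteq> 0"
    "\<And>w. r w \<noteq> 0 \<Longrightarrow> q w \<noteq> 0 \<and> g w = p w / q w"
proof -
  obtain p q U where U: "is_poly2 p" "is_poly2 q" "zariski_open U" "z \<in> U"
    "\<And>w. w \<in> U \<Longrightarrow> q w \<noteq> 0 \<and> g w = p w / q w"
    using assms unfolding regular_at_def by blast
  obtain r where "is_poly2 r" "r z \<noteq> 0" "\<And>w. r w \<noteq> 0 \<Longrightarrow> w \<in> U"
    using zariski_openE U(3,4) by blast
  then show ?thesis using that[of p q r] U by blast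
qed

lemma regular_atI:
  assumes "is_poly2 p" "is_poly2 q" "is_poly2 r" "r z \<noteq> 0"
    "\<And>w. r w \<noteq> 0 \<Longrightarrow> q w \<noteq> 0 \<and> g w = p w / q w"
  shows "regular_at g z"
  unfolding regular_at_def
  by (intro exI[of _ p] exI[of _ q] exI[of _ "{w. r w \<noteq> 0}"])
    (use assms zariski_open_nonzero in auto)

lemma regular_at_mult:
  assumes "regular_at f z" "regular_at g z"
  shows "regular_at (\<lambda>w. f w * g w) z"
proof -
  obtain p q r where 1: "is_poly2 p" "is_poly2 q" "is_poly2 r" "r z \<noteq> 0"
    "\<And>w. r w \<noteq> 0 \<Longrightarrow> q w \<noteq> 0 \<and> f w = p w / q w" using regular_atE[OF assms(1)] by blast
  obtain p' q' r' where 2: "is_poly2 p'" "is_poly2 q'" "is_poly2 r'" "r' z \<noteq> 0"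
    "\<And>w. r' w \<noteq> 0 \<Longrightarrow> q' w \<noteq> 0 \<and> g w = p' w / q' w" using regular_atE[OF assms(2)] by blast
  show ?thesis
    by (rule regular_atI[of "\<lambda>w. p w * p' w" "\<lambda>w. q w * q' w" "\<lambda>w. r w * r' w"])
      (use 1 2 in \<open>auto intro: is_poly2_mult\<close>)
qed

text \<open>Numerator, denominator and the polynomial cutting out the open set are all pulled back.
  The assumption on \<open>\<phi>\<close> says that it is a polynomial map, which covers both charts
  and the exchange of coordinates.\<close>

lemma regular_at_compose:
  assumes "regular_at f (\<phi> z)" and \<phi>: "\<And>p. is_poly2 p \<Longrightarrow> is_poly2 (p \<circ> \<phi>)"
  shows "regular_at (f \<circ> \<phi>) z"
proof -
  obtain p q r where 1: "is_poly2 p" "is_poly2 q" "is_poly2 r" "r (\<phi> z) \<noteq> 0"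
    "\<And>w. r w \<noteq> 0 \<Longrightarrow> q w \<noteq> 0 \<and> f w = p w / q w" using regular_atE[OF assms(1)] by blast
  show ?thesis
    by (rule regular_atI[OF \<phi>[OF 1(1)] \<phi>[OF 1(2)] \<phi>[OF 1(3)]]) (use 1 in auto)
qed

text \<open>Blowing up the union of the two sets of centres makes both factors regular, because
  blowing up further points does not destroy regularity.\<close>

lemma regular_after_blowup_mult:
  assumes "regular_after_blowup f S" "regular_after_blowup g T"
  shows "regular_after_blowup (\<lambda>z. f z * g z) (S \<union> T)"
proof -
  have charts: "regular_at (e \<circ> blowup_chart1 a) (0, t) \<and> regular_at (e \<circ> blowup_chart2 a) (t, 0)"
    if e: "regular_after_blowup e R" for e R a t
  proof (cases "a \<in> R")
    case True
    then show ?thesis using e unfolding regular_after_blowup_def by blast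
  next
    case False
    \<comment> \<open>At a centre that the function \<open>e\<close> does not need, \<open>e\<close>
      is already regular, and the charts contract the divisor to that point; hence the pullback is
      regular along the divisor.\<close>
    have "blowup_chart1 a (0, t) = a" "blowup_chart2 a (t, 0) = a"
      by (simp_all add: blowup_chart1_def blowup_chart2_def)
    moreover have "regular_at e a" using False e unfolding regular_after_blowup_def by blast
    ultimately show ?thesis
      by (intro conjI regular_at_compose is_poly2_chart1 is_poly2_chart2) simp_all
  qed
  have "regular_at ((\<lambda>z. f z * g z) \<circ> blowup_chart1 a) (0, t)"
    "regular_at ((\<lambda>z. f z * g z) \<circ> blowup_chart2 a) (t, 0)" for a t
    using charts[OF assms(1), of a t] charts[OF assms(2), of a t] regular_at_mult
    unfolding comp_def by blast+
  then show ?thesis using assms regular_at_mult unfolding regular_after_blowup_def by auto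
qed

section \<open>Functions of class C^k\<close>

lemma Ck_continuous: "Ck k f \<Longrightarrow> continuous_on UNIV f"
  by (cases k) (auto simp: continuous_on_eq_continuous_at dest: has_derivative_continuous)

lemma Ck_SucI:
  assumes "\<And>z. (f has_derivative (\<lambda>w. f1 z * fst w + f2 z * snd w)) (at z)"
    and "Ck k f1" "Ck k f2"
  shows "Ck (Suc k) f"
  unfolding Ck.simps(2) using assms by (intro exI[of _ f1] exI[of _ f2]) simp

lemma Ck_SucE:
  assumes "Ck (Suc k) f"
  obtains f1 f2 where
    "\<And>z. (f has_derivative (\<lambda>w. f1 z * fst w + f2 z * snd w)) (at z)" "Ck k f1" "Ck k f2"
  using assms unfolding Ck.simps(2) by blast

lemma Ck_SucD: "Ck (Suc k) f \<Longrightarrow> Ck k f"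
proof (induction k arbitrary: f)
  case 0
  then show ?case using Ck_continuous[OF 0] by simp
next
  case (Suc k)
  then show ?case by (metis Ck_SucE Ck_SucI)
qed

lemma Ck_add: "Ck k f \<Longrightarrow> Ck k g \<Longrightarrow> Ck k (\<lambda>z. f z + g z)"
proof (induction k arbitrary: f g)
  case 0
  then show ?case by (auto intro: continuous_intros)
next
  case (Suc k)
  then obtain f1 f2 g1 g2 where
    d: "\<And>z. (f has_derivative (\<lambda>w. f1 z * fst w + f2 z * snd w)) (at z)"
      "\<And>z. (g has_derivative (\<lambda>w. g1 z * fst w + g2 z * snd w)) (at z)"
    and "Ck k f1" "Ck k f2" "Ck k g1" "Ck k g2" by auto
  then have C: "Ck k (\<lambda>z. f1 z + g1 z)" "Ck k (\<lambda>z. f2 z + g2 z)" using Suc.IH by auto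
  have "((\<lambda>z. f z + g z) has_derivative
      (\<lambda>w. (f1 z + g1 z) * fst w + (f2 z + g2 z) * snd w)) (at z)" for z
    using has_derivative_add[OF d(1)[of z] d(2)[of z]] by (simp add: algebra_simps)
  from Ck_SucI[OF this C] show ?case .
qed

lemma Ck_mult: "Ck k f \<Longrightarrow> Ck k g \<Longrightarrow> Ck k (\<lambda>z. f z * g z)"
proof (induction k arbitrary: f g)
  case 0
  then show ?case by (auto intro: continuous_intros)
next
  case (Suc k)
  then obtain f1 f2 g1 g2 where
    d: "\<And>z. (f has_derivative (\<lambda>w. f1 z * fst w + f2 z * snd w)) (at z)"
      "\<And>z. (g has_derivative (\<lambda>w. g1 z * fst w + g2 z * snd w)) (at z)"
    and c: "Ck k f1" "Ck k f2" "Ck k g1" "Ck k g2" by auto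
  have "Ck k f" "Ck k g" using Suc.prems by (blast intro: Ck_SucD)+
  then have "Ck k (\<lambda>z. f1 z * g z + f z * g1 z)" "Ck k (\<lambda>z. f2 z * g z + f z * g2 z)"
    using c by (auto intro!: Ck_add Suc.IH)
  then show ?case using Ck_SucI[OF has_derivative_mult_partials[OF d]] by blast
qed

text \<open>Evaluating the unique derivative at the unit vectors gives the coefficients. This
  identifies partials that come from different sources, as \<open>Ck\<close> only asserts that some
  exist.\<close>

lemma partials_unique:
  fixes f :: "real \<times> real \<Rightarrow> real"
  assumes "(f has_derivative (\<lambda>w. c1 * fst w + c2 * snd w)) (at z)"
    and "(f has_derivative (\<lambda>w. d1 * fst w + d2 * snd w)) (at z)"
  shows "c1 = d1" "c2 = d2"
proof -
  have "(\<lambda>w. c1 * fst w + c2 * snd w) = (\<lambda>w. d1 * fst w + d2 * snd w)"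
    by (rule has_derivative_unique[OF assms])
  from fun_cong[OF this, of "(1,0)"] fun_cong[OF this, of "(0,1)"]
  show "c1 = d1" "c2 = d2" by simp_all
qed

section \<open>Locally rational functions\<close>

text \<open>Agreement is asked on a Euclidean neighbourhood and not on a Zariski open set, since
  differentiation is local in the Euclidean topology.\<close>

definition rational_near :: "(real \<times> real \<Rightarrow> real) \<Rightarrow> real \<times> real \<Rightarrow> bool" where
  "rational_near f z \<longleftrightarrow> (\<exists>p q. is_poly2 p \<and> is_poly2 q \<and> q z \<noteq> 0 \<and>
     (\<forall>\<^sub>F w in nhds z. f w = p w / q w))"

lemma rational_near_isCont:
  assumes "rational_near f z"
  shows "isCont f z"
proof -
  obtain p q where pq: "is_poly2 p" "is_poly2 q" "q z \<noteq> 0" "\<forall>\<^sub>F w in nhds z. f w = p w / q w"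
    using assms unfolding rational_near_def by blast
  have "isCont (\<lambda>w. p w / q w) z" using pq(1-3) is_poly2_isCont by (intro continuous_intros)
  then show ?thesis using isCont_cong[OF pq(4)] by simp
qed

lemma has_derivative_divide_partials:
  fixes p q :: "real \<times> real \<Rightarrow> real"
  assumes "(p has_derivative (\<lambda>w. p1 * fst w + p2 * snd w)) (at z)"
    and "(q has_derivative (\<lambda>w. q1 * fst w + q2 * snd w)) (at z)"
    and "q z \<noteq> 0"
  shows "((\<lambda>w. p w / q w) has_derivative (\<lambda>w. (p1 * q z - p z * q1) / (q z)\<^sup>2 * fst w
    + (p2 * q z - p z * q2) / (q z)\<^sup>2 * snd w)) (at z)"
  by (rule has_derivative_eq_rhs, rule has_derivative_divide'[OF assms])
    (use assms(3) in \<open>auto simp: fun_eq_iff divide_simps power2_eq_square algebra_simps\<close>)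

lemma rational_near_partials:
  assumes "rational_near f z"
  obtains p1 p2 r where "is_poly2 p1" "is_poly2 p2" "is_poly2 r" "r z \<noteq> 0"
    "\<forall>\<^sub>F w in nhds z. (f has_derivative (\<lambda>d. p1 w / r w * fst d + p2 w / r w * snd d)) (at w)"
proof -
  obtain p q where pq: "is_poly2 p" "is_poly2 q" "q z \<noteq> 0" "\<forall>\<^sub>F w in nhds z. f w = p w / q w"
    using assms unfolding rational_near_def by blast
  obtain p1 p2 where p: "is_poly2 p1" "is_poly2 p2"
    "\<And>z. (p has_derivative (\<lambda>w. p1 z * fst w + p2 z * snd w)) (at z)"
    using is_poly2_has_derivative[OF pq(1)] by blast
  obtain q1 q2 where q: "is_poly2 q1" "is_poly2 q2"
    "\<And>z. (q has_derivative (\<lambda>w. q1 z * fst w + q2 z * snd w)) (at z)"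
    using is_poly2_has_derivative[OF pq(2)] by blast
  \<comment> \<open>To differentiate at a point \<open>w\<close> near \<open>z\<close>, the quotient
    formula must hold on a whole neighbourhood of \<open>w\<close>.\<close>
  have "\<forall>\<^sub>F w in nhds z. \<forall>\<^sub>F w' in nhds w. f w' = p w' / q w'"
    using pq(4) by (simp add: eventually_eventually)
  moreover have "\<forall>\<^sub>F w in nhds z. q w \<noteq> 0" by (rule is_poly2_eventually_nonzero) fact+
  ultimately have "\<forall>\<^sub>F w in nhds z. (f has_derivative
     (\<lambda>d. (p1 w * q w - p w * q1 w) / (q w)\<^sup>2 * fst d
        + (p2 w * q w - p w * q2 w) / (q w)\<^sup>2 * snd d)) (at w)"
  proof eventually_elim
    case (elim w)
    have "\<forall>\<^sub>F w' in at w. p w' / q w' = f w'"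
      using elim(1) by (auto simp: eventually_at_filter elim: eventually_mono)
    moreover have "p w / q w = f w" using elim(1) eventually_nhds_x_imp_x by force
    ultimately show ?case
      using has_derivative_transform_eventually[OF has_derivative_divide_partials[OF p(3) q(3) elim(2)]]
      by blast
  qed
  then show ?thesis
    using pq p(1,2) q(1,2)
    by (intro that[of "\<lambda>w. p1 w * q w - p w * q1 w" "\<lambda>w. p2 w * q w - p w * q2 w" "\<lambda>w. (q w)\<^sup>2"]
        is_poly2_intros) simp_all
qed

text \<open>By uniqueness of partials, \<open>f1\<close> and \<open>f2\<close> are near
  \<open>z\<close> the functions given by the quotient rule.\<close>

lemma rational_near_derivative:
  assumes "rational_near f z"
    and "\<forall>\<^sub>F w in nhds z. (f has_derivative (\<lambda>d. f1 w * fst d + f2 w * snd d)) (at w)"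
  shows "rational_near f1 z" "rational_near f2 z"
proof -
  obtain p1 p2 r where r: "is_poly2 p1" "is_poly2 p2" "is_poly2 r" "r z \<noteq> 0"
    "\<forall>\<^sub>F w in nhds z. (f has_derivative (\<lambda>d. p1 w / r w * fst d + p2 w / r w * snd d)) (at w)"
    using rational_near_partials[OF assms(1)] by blast
  have "\<forall>\<^sub>F w in nhds z. f1 w = p1 w / r w" "\<forall>\<^sub>F w in nhds z. f2 w = p2 w / r w"
    using assms(2) r(5) by (eventually_elim, use partials_unique in blast)+
  then show "rational_near f1 z" "rational_near f2 z"
    using r(1-4) unfolding rational_near_def by blast+
qed

text \<open>Continuity turns an identity of rational functions into one of values. The set where
  \<open>f q = p\<close> is closed and contains all points where a nonzero polynomial
  \<open>r\<close> does not vanish. These points are dense by the identity principle, so the set is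
  the whole plane, and one may divide by \<open>q\<close> near \<open>a\<close>.\<close>

lemma rat_regular_at_imp_rational_near:
  assumes "rat_regular_at f a" and cont: "continuous_on UNIV f"
  shows "rational_near f a"
proof -
  obtain p q U where pq: "is_poly2 p" "is_poly2 q" "q a \<noteq> 0" and U: "zariski_open U" "U \<noteq> {}"
    "\<And>z. z \<in> U \<Longrightarrow> q z \<noteq> 0 \<and> f z = p z / q z"
    using assms(1) unfolding rat_regular_at_def by blast
  obtain z r where r: "is_poly2 r" "r z \<noteq> 0" "\<And>w. r w \<noteq> 0 \<Longrightarrow> w \<in> U"
    using U(1,2) zariski_openE by (metis ex_in_conv)
  let ?A = "{w. f w * q w = p w}"
  have "closed ?A"
    by (intro closed_Collect_eq continuous_intros is_poly2_continuous_on pq cont)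
  have "w \<in> ?A" for w
  proof (rule ccontr)
    assume "w \<notin> ?A"
    then have "\<forall>\<^sub>F v in nhds w. v \<in> - ?A"
      using \<open>closed ?A\<close> by (intro eventually_nhds_in_open) auto
    moreover have "v \<in> ?A" if "r v \<noteq> 0" for v using U(3)[OF r(3)[OF that]] by simp
    ultimately have "\<forall>\<^sub>F v in nhds w. r v = 0"
      by (metis (mono_tags, lifting) ComplD eventually_mono)
    then show False using is_poly2_zero_locally r(1,2) by blast
  qed
  then have "f w = p w / q w" if "q w \<noteq> 0" for w using that by (simp add: eq_divide_eq)
  then have "\<forall>\<^sub>F w in nhds a. f w = p w / q w"
    using is_poly2_eventually_nonzero[OF pq(2,3)] by (auto elim: eventually_mono)
  then show ?thesis using pq unfolding rational_near_def by blast
qed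

section \<open>Functions that are rational along the exceptional divisor\<close>

text \<open>Nothing is required on the exceptional divisor itself, so the value at the
  centre is irrelevant.\<close>

definition chart1_rational ::
    "(real \<times> real \<Rightarrow> real) \<Rightarrow> real \<times> real \<Rightarrow> real \<Rightarrow> bool" where
  "chart1_rational f a t \<longleftrightarrow> (\<exists>p q. is_poly2 p \<and> is_poly2 q \<and> q (0, t) \<noteq> 0 \<and>
     (\<forall>\<^sub>F w in nhds (0, t). fst w \<noteq> 0 \<longrightarrow> f (blowup_chart1 a w) = p w / q w))"

text \<open>Exchanging the coordinates turns the second chart into the first.\<close>

definition blowup_rational :: "(real \<times> real \<Rightarrow> real) \<Rightarrow> real \<times> real \<Rightarrow> bool" where
  "blowup_rational f a \<longleftrightarrow>
     (\<forall>t. chart1_rational f a t \<and> chart1_rational (f \<circ> prod.swap) (prod.swap a) t)"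

section \<open>Geometry of the charts and passage from regular functions\<close>

lemma chart2_swap: "blowup_chart2 a w = prod.swap (blowup_chart1 (prod.swap a) (prod.swap w))"
  by (simp add: blowup_chart1_def blowup_chart2_def mult.commute)

lemma chart1_has_derivative:
  "(blowup_chart1 a has_derivative (\<lambda>d. (fst d, fst d * snd w + fst w * snd d))) (at w)"
  unfolding blowup_chart1_def by (auto intro!: derivative_eq_intros)

lemma chart1_tendsto: "filterlim (blowup_chart1 a) (nhds a) (nhds (0, t))"
proof -
  have "isCont (blowup_chart1 a) (0, t)" by (rule has_derivative_continuous[OF chart1_has_derivative])
  moreover have "blowup_chart1 a (0, t) = a" by (simp add: blowup_chart1_def)
  ultimately show ?thesis by (simp add: isCont_def tendsto_nhds_iff)
qed

lemma regular_at_imp_chart1_rational: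
  assumes "regular_at (f \<circ> blowup_chart1 a) (0, t)"
  shows "chart1_rational f a t"
proof -
  obtain p q r where r: "is_poly2 p" "is_poly2 q" "is_poly2 r" "r (0, t) \<noteq> 0"
    "\<And>w. r w \<noteq> 0 \<Longrightarrow> q w \<noteq> 0 \<and> (f \<circ> blowup_chart1 a) w = p w / q w"
    using regular_atE[OF assms] by blast
  have "\<forall>\<^sub>F w in nhds (0, t). fst w \<noteq> 0 \<longrightarrow> f (blowup_chart1 a w) = p w / q w"
    using is_poly2_eventually_nonzero[OF r(3,4)] by eventually_elim (use r(5) in auto)
  then show ?thesis using r unfolding chart1_rational_def by blast
qed

lemma regular_after_blowup_imp_blowup_rational:
  assumes "regular_after_blowup f S" "a \<in> S"
  shows "blowup_rational f a"
  unfolding blowup_rational_def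
proof (intro allI conjI regular_at_imp_chart1_rational)
  fix t
  show "regular_at (f \<circ> blowup_chart1 a) (0, t)"
    using assms unfolding regular_after_blowup_def by blast
  \<comment> \<open>The exchange of chart coordinates moves the divisor of the second chart to the
    line where the first coordinate is 0.\<close>
  have "regular_at ((f \<circ> blowup_chart2 a) \<circ> prod.swap) (0, t)"
  proof (rule regular_at_compose)
    show "regular_at (f \<circ> blowup_chart2 a) (prod.swap (0, t))"
      using assms unfolding regular_after_blowup_def by simp
  qed (use is_poly2_swap in \<open>simp add: comp_def\<close>)
  moreover have "(f \<circ> blowup_chart2 a) \<circ> prod.swap = f \<circ> prod.swap \<circ> blowup_chart1 (prod.swap a)"
    by (simp add: fun_eq_iff chart2_swap)
  ultimately show "regular_at (f \<circ> prod.swap \<circ> blowup_chart1 (prod.swap a)) (0, t)" by simp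
qed

text \<open>Continuity at the centre makes f constant along the exceptional divisor, so that
  \<open>f = f(a) + u g/q\<close> in the chart. The chain rule gives \<open>u f\<^sub>y = \<partial>\<^sub>v (u g/q)\<close> and the factor
  u cancels: this is why the partial derivatives have no pole along the divisor.\<close>

lemma chart1_rational_derivative:
  assumes "chart1_rational f a t" "isCont f a"
    and deriv: "\<forall>\<^sub>F z in at a. (f has_derivative (\<lambda>d. f1 z * fst d + f2 z * snd d)) (at z)"
  shows "chart1_rational f1 a t" "chart1_rational f2 a t"
proof -
  let ?ch = "blowup_chart1 a"
  obtain p q where pq: "is_poly2 p" "is_poly2 q" "q (0, t) \<noteq> 0"
    and ev: "\<forall>\<^sub>F w in nhds (0, t). fst w \<noteq> 0 \<longrightarrow> f (?ch w) = p w / q w"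
    using assms(1) unfolding chart1_rational_def by blast
  have evq: "\<forall>\<^sub>F w in nhds (0, t). q w \<noteq> 0" by (rule is_poly2_eventually_nonzero) fact+
  have ev': "\<forall>\<^sub>F w in nhds (0, t). \<forall>\<^sub>F w' in nhds w. fst w' \<noteq> 0 \<longrightarrow> f (?ch w') = p w' / q w'"
    using ev by (simp add: eventually_eventually)
  \<comment> \<open>For fixed \<open>v\<close> the point \<open>?ch (u, v)\<close> tends to
    \<open>a\<close> as \<open>u\<close> tends to 0. Comparing the limits of \<open>f\<close> and
    \<open>p/q\<close> along this path shows that \<open>p/q\<close> takes the value
    \<open>f a\<close> at \<open>(0, v)\<close>.\<close>
  have const: "p (0, v) - f a * q (0, v) = 0"
    if v: "\<forall>\<^sub>F w in nhds (0, v). fst w \<noteq> 0 \<longrightarrow> f (?ch w) = p w / q w" and "q (0, v) \<noteq> 0" for v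
  proof -
    have lim: "((\<lambda>u. (u, v)) \<longlongrightarrow> (0, v)) (at 0)" by (intro tendsto_intros)
    have "\<forall>\<^sub>F u in at 0. u \<noteq> 0 \<longrightarrow> f (?ch (u, v)) = p (u, v) / q (u, v)"
      using eventually_compose_filterlim[OF v lim] by simp
    then have eq: "\<forall>\<^sub>F u in at 0. f (?ch (u, v)) = p (u, v) / q (u, v)"
      by (simp add: eventually_at_filter)
    have "((\<lambda>u. f (?ch (u, v))) \<longlongrightarrow> f a) (at 0)"
      by (rule isCont_tendsto_compose[OF assms(2) filterlim_compose[OF chart1_tendsto lim]])
    moreover have "((\<lambda>u. p (u, v) / q (u, v)) \<longlongrightarrow> p (0, v) / q (0, v)) (at 0)"
      by (intro tendsto_divide isCont_tendsto_compose[OF is_poly2_isCont[OF pq(1)] lim]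
          isCont_tendsto_compose[OF is_poly2_isCont[OF pq(2)] lim] that(2))
    ultimately have "f a = p (0, v) / q (0, v)"
      unfolding tendsto_cong[OF eq] by (rule tendsto_unique[rotated]) simp
    then show ?thesis using that(2) by simp
  qed
  have "((\<lambda>v. (0, v)) \<longlongrightarrow> (0::real, t)) (nhds t)" by (intro tendsto_intros filterlim_ident)
  then have "\<forall>\<^sub>F v in nhds t. p (0, v) - f a * q (0, v) = 0"
    by (rule eventually_mono[OF eventually_compose_filterlim[OF eventually_conj[OF ev' evq]]])
      (use const in blast)
  moreover have "is_poly2 (\<lambda>w. p w - f a * q w)" by (intro is_poly2_intros pq)
  ultimately obtain g where g: "is_poly2 g" "\<And>w. p w - f a * q w = fst w * g w"
    using is_poly2_factor_fst[of "\<lambda>w. p w - f a * q w" t] by blast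
  obtain g1 g2 where dg: "is_poly2 g1" "is_poly2 g2"
    "\<And>z. (g has_derivative (\<lambda>w. g1 z * fst w + g2 z * snd w)) (at z)"
    using is_poly2_has_derivative[OF g(1)] by blast
  obtain q1 q2 where dq: "is_poly2 q1" "is_poly2 q2"
    "\<And>z. (q has_derivative (\<lambda>w. q1 z * fst w + q2 z * snd w)) (at z)"
    using is_poly2_has_derivative[OF pq(2)] by blast
  \<comment> \<open>\<open>A1\<close> and \<open>A2\<close> are the numerators, over the denominator
    \<open>q\<close> squared, of the two partials of \<open>g/q\<close>.\<close>
  define A1 where "A1 = (\<lambda>w. g1 w * q w - g w * q1 w)"
  define A2 where "A2 = (\<lambda>w. g2 w * q w - g w * q2 w)"
  have A: "is_poly2 A1" "is_poly2 A2"
    unfolding A1_def A2_def by (intro is_poly2_intros pq g dg dq)+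
  have "\<forall>\<^sub>F z in nhds a. z \<noteq> a \<longrightarrow> (f has_derivative (\<lambda>d. f1 z * fst d + f2 z * snd d)) (at z)"
    using deriv by (simp add: eventually_at_filter)
  then have "\<forall>\<^sub>F w in nhds (0, t). ?ch w \<noteq> a \<longrightarrow>
      (f has_derivative (\<lambda>d. f1 (?ch w) * fst d + f2 (?ch w) * snd d)) (at (?ch w))"
    using eventually_compose_filterlim[OF _ chart1_tendsto] by blast
  \<comment> \<open>Off the divisor the chart avoids the centre, so \<open>f\<close> is
    differentiable there. Its pullback is differentiated twice, by the chain rule and from the
    formula with \<open>g/q\<close>, and the results are compared.\<close>
  then have key: "\<forall>\<^sub>F w in nhds (0, t). fst w \<noteq> 0 \<longrightarrow>
      f1 (?ch w) = (g w * q w + fst w * A1 w - snd w * A2 w) / (q w)\<^sup>2 \<and> f2 (?ch w) = A2 w / (q w)\<^sup>2"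
    using ev' evq
  proof eventually_elim
    case (elim w)
    show ?case
    proof
      assume w: "fst w \<noteq> 0"
      then have "?ch w \<noteq> a" by (auto simp: blowup_chart1_def prod_eq_iff)
      with elim(1) have f: "(f has_derivative (\<lambda>d. f1 (?ch w) * fst d + f2 (?ch w) * snd d)) (at (?ch w))"
        by blast
      have 1: "((\<lambda>w. f (?ch w)) has_derivative
          (\<lambda>d. (f1 (?ch w) + snd w * f2 (?ch w)) * fst d + (fst w * f2 (?ch w)) * snd d)) (at w)"
        by (rule has_derivative_eq_rhs[OF has_derivative_compose[OF chart1_has_derivative f]])
          (simp add: algebra_simps)
      have "((\<lambda>w. fst w * (g w / q w)) has_derivative
          (\<lambda>d. (1 * (g w / q w) + fst w * (A1 w / (q w)\<^sup>2)) * fst d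
             + (0 * (g w / q w) + fst w * (A2 w / (q w)\<^sup>2)) * snd d)) (at w)"
        unfolding A1_def A2_def
        by (intro has_derivative_mult_partials has_derivative_divide_partials dg dq elim)
          (auto intro!: derivative_eq_intros)
      from has_derivative_add[OF has_derivative_const[of "f a"] this]
      have 2: "((\<lambda>w. f a + fst w * (g w / q w)) has_derivative
          (\<lambda>d. (g w / q w + fst w * (A1 w / (q w)\<^sup>2)) * fst d
             + (fst w * (A2 w / (q w)\<^sup>2)) * snd d)) (at w)" by simp
      have "\<forall>\<^sub>F w' in nhds w. fst w' \<noteq> 0"
        by (rule is_poly2_eventually_nonzero[OF is_poly2_fst w])
      moreover have "\<forall>\<^sub>F w' in nhds w. q w' \<noteq> 0"
        by (rule is_poly2_eventually_nonzero[OF pq(2)]) fact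
      ultimately have eq: "\<forall>\<^sub>F w' in nhds w. f a + fst w' * (g w' / q w') = f (?ch w')"
        using elim(2)
      proof eventually_elim
        case (elim w')
        then have "f (?ch w') = p w' / q w'" by blast
        also have "p w' = f a * q w' + fst w' * g w'" using g(2)[of w'] by simp
        finally show ?case using elim by (simp add: add_divide_distrib)
      qed
      have "((\<lambda>w. f (?ch w)) has_derivative
          (\<lambda>d. (g w / q w + fst w * (A1 w / (q w)\<^sup>2)) * fst d
             + (fst w * (A2 w / (q w)\<^sup>2)) * snd d)) (at w)"
      proof (rule has_derivative_transform_eventually[OF 2])
        show "\<forall>\<^sub>F w' in at w. f a + fst w' * (g w' / q w') = f (?ch w')"
          using eq by (auto simp: eventually_at_filter elim: eventually_mono)
        show "f a + fst w * (g w / q w) = f (?ch w)" using eventually_nhds_x_imp_x[OF eq] .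
      qed auto
      note eqs = partials_unique[OF 1 this]
      \<comment> \<open>The comparison in the second coordinate reads
        \<open>u f2 = u A2/q^2\<close>, with \<open>u\<close> nonzero. Once \<open>f2\<close> is
        known, the first coordinate determines \<open>f1\<close>.\<close>
      have f2: "f2 (?ch w) = A2 w / (q w)\<^sup>2" using eqs(2) mult_left_cancel[OF w] by blast
      have "f1 (?ch w) = g w / q w + fst w * (A1 w / (q w)\<^sup>2) - snd w * (A2 w / (q w)\<^sup>2)"
        using eqs(1) unfolding f2 by linarith
      also have "\<dots> = (g w * q w + fst w * A1 w - snd w * A2 w) / (q w)\<^sup>2"
        using elim(3) by (simp add: field_simps power2_eq_square)
      finally show "f1 (?ch w) = (g w * q w + fst w * A1 w - snd w * A2 w) / (q w)\<^sup>2
        \<and> f2 (?ch w) = A2 w / (q w)\<^sup>2" using f2 by blast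
    qed
  qed
  have q2: "is_poly2 (\<lambda>w. (q w)\<^sup>2)" "(q (0, t))\<^sup>2 \<noteq> 0" using pq by (auto intro: is_poly2_intros)
  have "is_poly2 (\<lambda>w. g w * q w + fst w * A1 w - snd w * A2 w)"
    by (intro is_poly2_intros pq g A)
  then show "chart1_rational f1 a t"
    unfolding chart1_rational_def using q2 key
    by (intro exI[of _ "\<lambda>w. g w * q w + fst w * A1 w - snd w * A2 w"] exI[of _ "\<lambda>w. (q w)\<^sup>2"])
      (auto elim: eventually_mono)
  show "chart1_rational f2 a t"
    unfolding chart1_rational_def using q2 key A
    by (intro exI[of _ A2] exI[of _ "\<lambda>w. (q w)\<^sup>2"]) (auto elim: eventually_mono)
qed

lemma swap_isCont: "isCont (prod.swap :: real \<times> real \<Rightarrow> real \<times> real) z"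
  unfolding prod.swap_def by (intro continuous_intros)

text \<open>The first chart is settled directly. For the second one, the same result is applied to
  \<open>f\<close> with exchanged coordinates, whose partials are \<open>f2\<close> and
  \<open>f1\<close> with exchanged coordinates, in this order.\<close>

lemma blowup_rational_derivative:
  assumes "blowup_rational f a" and cont: "isCont f a"
    and deriv: "\<forall>\<^sub>F z in at a. (f has_derivative (\<lambda>d. f1 z * fst d + f2 z * snd d)) (at z)"
  shows "blowup_rational f1 a" "blowup_rational f2 a"
proof -
  let ?s = "prod.swap :: real \<times> real \<Rightarrow> real \<times> real"
  have "filterlim ?s (nhds a) (nhds (?s a))"
    using swap_isCont[of "?s a"] by (simp add: isCont_def tendsto_nhds_iff)
  moreover have "\<forall>\<^sub>F z in nhds a. z \<noteq> a \<longrightarrow>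
      (f has_derivative (\<lambda>d. f1 z * fst d + f2 z * snd d)) (at z)"
    using deriv by (simp add: eventually_at_filter)
  ultimately have "\<forall>\<^sub>F z in nhds (?s a). ?s z \<noteq> a \<longrightarrow>
      (f has_derivative (\<lambda>d. f1 (?s z) * fst d + f2 (?s z) * snd d)) (at (?s z))"
    using eventually_compose_filterlim by blast
  then have "\<forall>\<^sub>F z in nhds (?s a). z \<noteq> ?s a \<longrightarrow>
      ((f \<circ> ?s) has_derivative (\<lambda>d. (f2 \<circ> ?s) z * fst d + (f1 \<circ> ?s) z * snd d)) (at z)"
  proof eventually_elim
    case (elim z)
    show ?case
    proof
      assume "z \<noteq> ?s a"
      then have "?s z \<noteq> a" by (metis swap_swap)
      with elim have f: "(f has_derivative (\<lambda>d. f1 (?s z) * fst d + f2 (?s z) * snd d)) (at (?s z))"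
        by blast
      have "(?s has_derivative (\<lambda>d. (snd d, fst d))) (at z)"
        unfolding prod.swap_def by (auto intro!: derivative_eq_intros)
      from has_derivative_eq_rhs[OF has_derivative_compose[OF this f]]
      show "((f \<circ> ?s) has_derivative (\<lambda>d. (f2 \<circ> ?s) z * fst d + (f1 \<circ> ?s) z * snd d)) (at z)"
        by (simp add: comp_def add.commute)
    qed
  qed
  then have deriv': "\<forall>\<^sub>F z in at (?s a).
      ((f \<circ> ?s) has_derivative (\<lambda>d. (f2 \<circ> ?s) z * fst d + (f1 \<circ> ?s) z * snd d)) (at z)"
    by (simp add: eventually_at_filter)
  have cont': "isCont (f \<circ> ?s) (?s a)"
    using cont swap_isCont by (intro continuous_at_compose) auto
  show "blowup_rational f1 a" "blowup_rational f2 a"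
    using assms(1) chart1_rational_derivative[OF _ cont deriv]
      chart1_rational_derivative[OF _ cont' deriv']
    unfolding blowup_rational_def by blast+
qed

text \<open>Near each point of the divisor \<open>f\<close> is bounded, as a quotient with
  nonvanishing denominator. Compactness of the segment with slopes between -1 and 1 makes the bound
  uniform.\<close>

lemma chart1_rational_bounded:
  assumes "\<And>t. chart1_rational f a t"
  obtains C \<delta> where "\<delta> > 0"
    "\<And>u v. u \<noteq> 0 \<Longrightarrow> \<bar>u\<bar> < \<delta> \<Longrightarrow> \<bar>v\<bar> \<le> 1 \<Longrightarrow> \<bar>f (blowup_chart1 a (u, v))\<bar> \<le> C"
proof -
  let ?ch = "blowup_chart1 a"
  have "\<exists>U C. open U \<and> (0, t) \<in> U \<and> (\<forall>w\<in>U. fst w \<noteq> 0 \<longrightarrow> \<bar>f (?ch w)\<bar> \<le> C)" for t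
  proof -
    obtain p q where pq: "is_poly2 p" "is_poly2 q" "q (0, t) \<noteq> 0"
      and ev: "\<forall>\<^sub>F w in nhds (0, t). fst w \<noteq> 0 \<longrightarrow> f (?ch w) = p w / q w"
      using assms unfolding chart1_rational_def by blast
    let ?c = "\<bar>p (0, t) / q (0, t)\<bar>"
    have "isCont (\<lambda>w. \<bar>p w / q w\<bar>) (0, t)"
      using pq is_poly2_isCont by (intro continuous_intros)
    then have "((\<lambda>w. \<bar>p w / q w\<bar>) \<longlongrightarrow> ?c) (nhds (0, t))"
      by (simp add: isCont_def tendsto_nhds_iff)
    then have "\<forall>\<^sub>F w in nhds (0, t). \<bar>p w / q w\<bar> < ?c + 1" by (rule order_tendstoD) simp
    with ev have "\<forall>\<^sub>F w in nhds (0, t). fst w \<noteq> 0 \<longrightarrow> \<bar>f (?ch w)\<bar> \<le> ?c + 1"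
      by eventually_elim auto
    then show ?thesis unfolding eventually_nhds by blast
  qed
  then obtain U C where U: "\<And>t. open (U t)" "\<And>t. (0, t) \<in> U t"
    "\<And>t w. w \<in> U t \<Longrightarrow> fst w \<noteq> 0 \<Longrightarrow> \<bar>f (?ch w)\<bar> \<le> C t" by metis
  let ?K = "{0} \<times> {-1..1::real}"
  have K: "compact ?K" by (intro compact_Times) auto
  have "?K \<subseteq> (\<Union>t\<in>{-1..1}. U t)" using U(2) by auto
  then obtain T where T: "T \<subseteq> {-1..1}" "finite T" "?K \<subseteq> (\<Union>t\<in>T. U t)"
    using compactE_image[OF K, of "{-1..1}" U] U(1) by blast
  \<comment> \<open>The union of the finite subcover contains a neighbourhood of the segment of
    uniform radius, so \<open>\<delta>\<close> does not depend on the slope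
    \<open>v\<close>.\<close>
  obtain \<delta> where \<delta>: "\<delta> > 0" "(\<Union>x\<in>?K. ball x \<delta>) \<subseteq> (\<Union>t\<in>T. U t)"
    using compact_subset_open_imp_ball_epsilon_subset[OF K _ T(3)] U(1) by blast
  \<comment> \<open>The sum of the absolute values dominates each of the finitely many local
    bounds.\<close>
  have "\<bar>f (?ch (u, v))\<bar> \<le> (\<Sum>t\<in>T. \<bar>C t\<bar>)" if "u \<noteq> 0" "\<bar>u\<bar> < \<delta>" "\<bar>v\<bar> \<le> 1" for u v
  proof -
    have "(u, v) \<in> ball (0, v) \<delta>" using that by (simp add: dist_Pair_Pair dist_real_def)
    moreover have "(0, v) \<in> ?K" using that by auto
    ultimately obtain t where t: "t \<in> T" "(u, v) \<in> U t" using \<delta>(2) by blast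
    have "\<bar>f (?ch (u, v))\<bar> \<le> \<bar>C t\<bar>" using U(3)[OF t(2)] that(1) by force
    also have "\<dots> \<le> (\<Sum>t\<in>T. \<bar>C t\<bar>)" using t(1) T(2) by (intro member_le_sum) auto
    finally show ?thesis .
  qed
  then show ?thesis using that \<delta>(1) by blast
qed

text \<open>A punctured neighbourhood of \<open>a\<close> is covered by two cones. Dividing the
  smaller displacement by the larger one gives a chart coordinate of absolute value at most 1, in
  the first chart or, after exchange, in the second.\<close>

lemma blowup_rational_bounded:
  assumes "blowup_rational f a"
  obtains C where "\<forall>\<^sub>F z in at a. \<bar>f z\<bar> \<le> C"
proof -
  obtain C \<delta> where 1: "\<delta> > 0"
    "\<And>u v. u \<noteq> 0 \<Longrightarrow> \<bar>u\<bar> < \<delta> \<Longrightarrow> \<bar>v\<bar> \<le> 1 \<Longrightarrow> \<bar>f (blowup_chart1 a (u, v))\<bar> \<le> C"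
    using chart1_rational_bounded[of f a] assms unfolding blowup_rational_def by metis
  obtain D \<epsilon> where 2: "\<epsilon> > 0"
    "\<And>u v. u \<noteq> 0 \<Longrightarrow> \<bar>u\<bar> < \<epsilon> \<Longrightarrow> \<bar>v\<bar> \<le> 1 \<Longrightarrow>
      \<bar>(f \<circ> prod.swap) (blowup_chart1 (prod.swap a) (u, v))\<bar> \<le> D"
    using chart1_rational_bounded[of "f \<circ> prod.swap" "prod.swap a"] assms
    unfolding blowup_rational_def by metis
  have "\<bar>f z\<bar> \<le> max C D" if z: "z \<noteq> a" "dist z a < min \<delta> \<epsilon>" for z
  proof -
    define x where "x = fst z - fst a"
    define y where "y = snd z - snd a"
    have small: "\<bar>x\<bar> < \<delta>" "\<bar>y\<bar> < \<epsilon>"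
      using z(2) dist_fst_le[of z a] dist_snd_le[of z a] by (auto simp: x_def y_def dist_real_def)
    have nz: "x \<noteq> 0 \<or> y \<noteq> 0" using z(1) by (auto simp: x_def y_def prod_eq_iff)
    show ?thesis
    proof (cases "\<bar>y\<bar> \<le> \<bar>x\<bar>")
      case True
      then have "x \<noteq> 0" using nz by auto
      then have "z = blowup_chart1 a (x, y / x)" "\<bar>y / x\<bar> \<le> 1"
        using True by (auto simp: blowup_chart1_def x_def y_def prod_eq_iff abs_divide divide_le_eq_1)
      then show ?thesis using 1(2)[OF \<open>x \<noteq> 0\<close> small(1), of "y / x"] by simp
    next
      case False
      then have "y \<noteq> 0" by auto
      then have "prod.swap z = blowup_chart1 (prod.swap a) (y, x / y)" "\<bar>x / y\<bar> \<le> 1"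
        using False by (auto simp: blowup_chart1_def x_def y_def prod_eq_iff abs_divide divide_le_eq_1)
      then show ?thesis using 2(2)[OF \<open>y \<noteq> 0\<close> small(2), of "x / y"]
        by (metis comp_apply max.coboundedI2 swap_swap)
    qed
  qed
  then have "\<forall>\<^sub>F z in at a. \<bar>f z\<bar> \<le> max C D"
    unfolding eventually_at using 1(1) 2(1) by (intro exI[of _ "min \<delta> \<epsilon>"]) auto
  then show ?thesis by (rule that)
qed

section \<open>Gain of one derivative\<close>

text \<open>Since \<open>h a = 0\<close>, the increment of the product differs from
  \<open>h' d * f a\<close> by the remainder of \<open>h\<close> times \<open>f (a + d)\<close> plus
  \<open>h' d * (f (a + d) - f a)\<close>. The first term is small because \<open>h\<close> is
  differentiable, the second because \<open>f\<close> is continuous.\<close>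

lemma has_derivative_mult_vanishing:
  fixes f h :: "'a::real_normed_vector \<Rightarrow> real"
  assumes h: "(h has_derivative h') (at a)" and "h a = 0" and f: "isCont f a"
  shows "((\<lambda>z. h z * f z) has_derivative (\<lambda>d. h' d * f a)) (at a)"
  unfolding has_derivative_at
proof
  have bl: "bounded_linear h'" using h by (rule has_derivative_bounded_linear)
  then show "bounded_linear (\<lambda>d. h' d * f a)"
    by (rule bounded_linear_compose[OF bounded_linear_mult_left])
  obtain K where K: "\<And>d. norm (h' d) \<le> norm d * K" using bounded_linear.bounded[OF bl] by blast
  have h0: "((\<lambda>d. norm (h (a + d) - h a - h' d) / norm d) \<longlongrightarrow> 0) (at 0)"
    using h unfolding has_derivative_at by blast
  have fa: "((\<lambda>d. f (a + d)) \<longlongrightarrow> f a) (at 0)"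
    using f by (simp add: isCont_iff)
  have "((\<lambda>d. norm (h (a + d) - h a - h' d) / norm d * \<bar>f (a + d)\<bar> + K * \<bar>f (a + d) - f a\<bar>)
      \<longlongrightarrow> 0 * \<bar>f a\<bar> + K * \<bar>f a - f a\<bar>) (at 0)"
    by (intro tendsto_intros h0 fa)
  then have lim: "((\<lambda>d. norm (h (a + d) - h a - h' d) / norm d * \<bar>f (a + d)\<bar>
      + K * \<bar>f (a + d) - f a\<bar>) \<longlongrightarrow> 0) (at 0)" by simp
  show "((\<lambda>d. norm (h (a + d) * f (a + d) - h a * f a - h' d * f a) / norm d) \<longlongrightarrow> 0) (at 0)"
  proof (rule tendsto_sandwich[OF _ _ tendsto_const lim])
    show "\<forall>\<^sub>F d in at 0. 0 \<le> norm (h (a + d) * f (a + d) - h a * f a - h' d * f a) / norm d"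
      by simp
    have "norm (h (a + d) * f (a + d) - h a * f a - h' d * f a) / norm d
       \<le> norm (h (a + d) - h a - h' d) / norm d * \<bar>f (a + d)\<bar> + K * \<bar>f (a + d) - f a\<bar>"
      if "d \<noteq> 0" for d
    proof -
      have "h (a + d) * f (a + d) - h a * f a - h' d * f a
        = (h (a + d) - h a - h' d) * f (a + d) + h' d * (f (a + d) - f a)"
        using \<open>h a = 0\<close> by (simp add: algebra_simps)
      also have "norm \<dots> \<le> norm (h (a + d) - h a - h' d) * \<bar>f (a + d)\<bar> + norm (h' d) * \<bar>f (a + d) - f a\<bar>"
        by (rule order_trans[OF norm_triangle_ineq]) (simp add: abs_mult)
      also have "\<dots> \<le> norm (h (a + d) - h a - h' d) * \<bar>f (a + d)\<bar> + norm d * K * \<bar>f (a + d) - f a\<bar>"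
        using K[of d] by (intro add_left_mono mult_right_mono) auto
      finally show ?thesis using that by (simp add: field_simps)
    qed
    then show "\<forall>\<^sub>F d in at 0. norm (h (a + d) * f (a + d) - h a * f a - h' d * f a) / norm d
       \<le> norm (h (a + d) - h a - h' d) / norm d * \<bar>f (a + d)\<bar> + K * \<bar>f (a + d) - f a\<bar>"
      by (simp add: eventually_at_filter)
  qed
qed

text \<open>Near \<open>a\<close> the product is a null function times a bounded one. At
  \<open>a\<close> it is 0 whatever value \<open>g\<close> has there, so \<open>g\<close> may be a
  partial derivative with an arbitrary value at the centre.\<close>

lemma isCont_mult_vanishing:
  fixes g h :: "'a::real_normed_vector \<Rightarrow> real"
  assumes "isCont h a" "h a = 0" "\<forall>\<^sub>F z in at a. \<bar>g z\<bar> \<le> C"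
  shows "isCont (\<lambda>z. h z * g z) a"
proof -
  have "(h \<longlongrightarrow> 0) (at a)" using assms(1,2) by (simp add: isCont_def)
  moreover have "Bfun g (at a)" using assms(3) by (intro BfunI[of _ C]) simp
  ultimately have "((\<lambda>z. h z * g z) \<longlongrightarrow> 0) (at a)"
    by (simp add: tendsto_Zfun_iff bounded_bilinear.Zfun_prod_Bfun[OF bounded_bilinear_mult])
  then show ?thesis using assms(2) by (simp add: isCont_def)
qed

text \<open>The assumptions on \<open>f\<close> are stated through \<open>rational_near\<close> and
  \<open>blowup_rational\<close> because both pass to the partials of \<open>f\<close>. The
  induction therefore varies \<open>f\<close> and keeps \<open>h\<close> and
  \<open>S\<close>.\<close>

lemma Ck_Suc_mult:
  assumes "finite S"
    and "\<And>z. z \<notin> S \<Longrightarrow> rational_near f z" "\<And>a. a \<in> S \<Longrightarrow> blowup_rational f a"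
    and "Ck k f" "Ck (Suc k) h" "\<And>a. a \<in> S \<Longrightarrow> h a = 0"
  shows "Ck (Suc k) (\<lambda>z. h z * f z)"
  using assms
proof (induction k arbitrary: f)
  case (0 f)
  have cont: "isCont f z" for z
    using 0(4) by (simp add: continuous_on_eq_continuous_at del: split_paired_All)
  obtain h1 h2 where h: "\<And>z. (h has_derivative (\<lambda>w. h1 z * fst w + h2 z * snd w)) (at z)"
    and "Ck 0 h1" "Ck 0 h2" using Ck_SucE[OF 0(5)] by blast
  then have ch: "isCont h1 z" "isCont h2 z" for z
    by (simp_all add: continuous_on_eq_continuous_at del: split_paired_All)
  have conth: "isCont h z" for z using has_derivative_continuous[OF h] .
  have "\<exists>c d. (f has_derivative (\<lambda>w. c * fst w + d * snd w)) (at z)" if z: "z \<notin> S" for z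
  proof (rule rational_near_partials[OF 0(2)[OF z]])
    fix p1 p2 r
    assume "\<forall>\<^sub>F w in nhds z. (f has_derivative (\<lambda>d. p1 w / r w * fst d + p2 w / r w * snd d)) (at w)"
    from eventually_nhds_x_imp_x[OF this] show ?thesis by blast
  qed
  \<comment> \<open>Here \<open>f\<close> is merely continuous on \<open>S\<close>, so the partials
    are chosen off \<open>S\<close> and have arbitrary values on it.\<close>
  then obtain f1 f2 where
    f: "\<And>z. z \<notin> S \<Longrightarrow> (f has_derivative (\<lambda>w. f1 z * fst w + f2 z * snd w)) (at z)"
    by metis
  have off: "isCont f1 z" "isCont f2 z" if "z \<notin> S" for z
  proof -
    have "\<forall>\<^sub>F w in nhds z. w \<in> - S"
      using that \<open>finite S\<close> by (intro eventually_nhds_in_open) (auto intro: finite_imp_closed)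
    then have "\<forall>\<^sub>F w in nhds z. (f has_derivative (\<lambda>d. f1 w * fst d + f2 w * snd d)) (at w)"
      using f by (auto elim: eventually_mono)
    then show "isCont f1 z" "isCont f2 z"
      using rational_near_derivative[OF 0(2)[OF that]] rational_near_isCont by blast+
  qed
  have on: "isCont (\<lambda>z. h z * f1 z) a" "isCont (\<lambda>z. h z * f2 z) a" if "a \<in> S" for a
  proof -
    \<comment> \<open>A finite set has no limit points, so \<open>f\<close> is differentiable on a
      punctured neighbourhood of the centre.\<close>
    have "\<forall>\<^sub>F w in at a. w \<notin> S"
      using \<open>finite S\<close> islimpt_finite islimpt_iff_eventually by blast
    then have "\<forall>\<^sub>F w in at a. (f has_derivative (\<lambda>d. f1 w * fst d + f2 w * snd d)) (at w)"
      using f by (auto elim: eventually_mono)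
    note d = blowup_rational_derivative[OF 0(3)[OF that] cont this]
    obtain C where "\<forall>\<^sub>F z in at a. \<bar>f1 z\<bar> \<le> C" using blowup_rational_bounded[OF d(1)] .
    then show "isCont (\<lambda>z. h z * f1 z) a" using isCont_mult_vanishing[OF conth 0(6)[OF that]] by blast
    obtain C where "\<forall>\<^sub>F z in at a. \<bar>f2 z\<bar> \<le> C" using blowup_rational_bounded[OF d(2)] .
    then show "isCont (\<lambda>z. h z * f2 z) a" using isCont_mult_vanishing[OF conth 0(6)[OF that]] by blast
  qed
  have "isCont (\<lambda>z. h z * f1 z) z" "isCont (\<lambda>z. h z * f2 z) z" for z
    using on off conth by (cases "z \<in> S"; simp)+
  then have "isCont (\<lambda>z. h1 z * f z + h z * f1 z) z" "isCont (\<lambda>z. h2 z * f z + h z * f2 z) z" for z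
    using ch cont by (auto intro!: continuous_intros)
  then have C: "Ck 0 (\<lambda>z. h1 z * f z + h z * f1 z)" "Ck 0 (\<lambda>z. h2 z * f z + h z * f2 z)"
    by (auto intro: continuous_at_imp_continuous_on)
  have "((\<lambda>z. h z * f z) has_derivative (\<lambda>w. (h1 z * f z + h z * f1 z) * fst w
      + (h2 z * f z + h z * f2 z) * snd w)) (at z)" for z
  proof (cases "z \<in> S")
    case True
    \<comment> \<open>The factor \<open>h z = 0\<close> removes the arbitrary values of
      \<open>f1\<close> and \<open>f2\<close> and leaves \<open>f z\<close> times the derivative of
      \<open>h\<close>.\<close>
    show ?thesis
      by (rule has_derivative_eq_rhs[OF has_derivative_mult_vanishing[OF h 0(6)[OF True] cont]])
        (simp add: 0(6)[OF True] algebra_simps)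
  next
    case False
    then show ?thesis by (intro has_derivative_mult_partials h f)
  qed
  from Ck_SucI[OF this C] show ?case .
next
  case (Suc k f)
  obtain f1 f2 where f: "\<And>z. (f has_derivative (\<lambda>w. f1 z * fst w + f2 z * snd w)) (at z)"
    and C: "Ck k f1" "Ck k f2" using Ck_SucE[OF Suc.prems(4)] by blast
  obtain h1 h2 where h: "\<And>z. (h has_derivative (\<lambda>w. h1 z * fst w + h2 z * snd w)) (at z)"
    and H: "Ck (Suc k) h1" "Ck (Suc k) h2" using Ck_SucE[OF Suc.prems(5)] by blast
  have h': "Ck (Suc k) h" using Ck_SucD Suc.prems(5) by blast
  have R: "rational_near f1 z" "rational_near f2 z" if "z \<notin> S" for z
    by (rule rational_near_derivative[OF Suc.prems(2)[OF that] always_eventually[OF allI[OF f]]])+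
  have B: "blowup_rational f1 a" "blowup_rational f2 a" if "a \<in> S" for a
    by (rule blowup_rational_derivative[OF Suc.prems(3)[OF that] has_derivative_continuous[OF f]
          always_eventually[OF allI[OF f]]])+
  \<comment> \<open>The partials of \<open>f\<close> lose one order of smoothness and multiplication
    by \<open>h\<close> regains it. The other summands \<open>h1 f\<close> and \<open>h2 f\<close>
    are products of functions of class \<open>C^(k+1)\<close>.\<close>
  have "Ck (Suc k) (\<lambda>z. h z * f1 z)" "Ck (Suc k) (\<lambda>z. h z * f2 z)"
    using Suc.IH[OF \<open>finite S\<close> R(1) B(1) C(1) h' Suc.prems(6)]
      Suc.IH[OF \<open>finite S\<close> R(2) B(2) C(2) h' Suc.prems(6)] by simp_all
  then have "Ck (Suc k) (\<lambda>z. h1 z * f z + h z * f1 z)" "Ck (Suc k) (\<lambda>z. h2 z * f z + h z * f2 z)"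
    using Ck_add Ck_mult[OF H(1) Suc.prems(4)] Ck_mult[OF H(2) Suc.prems(4)] by blast+
  then show ?case by (rule Ck_SucI[OF has_derivative_mult_partials[OF h f]])
qed

text \<open>The two fraction representations hold on different Zariski open sets; irreducibility of
  the plane makes their intersection nonempty. Only the smoothness of the product has to be
  supplied.\<close>

lemma regulous_multI:
  assumes "regulous k f" "regulous l g" "Ck m (\<lambda>z. f z * g z)"
  shows "regulous m (\<lambda>z. f z * g z)"
proof -
  obtain p q U where f: "is_poly2 p" "is_poly2 q" "zariski_open U" "U \<noteq> {}"
    "\<And>z. z \<in> U \<Longrightarrow> q z \<noteq> 0 \<and> f z = p z / q z"
    using assms(1) unfolding regulous_def by blast
  obtain p' q' V where g: "is_poly2 p'" "is_poly2 q'" "zariski_open V" "V \<noteq> {}"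
    "\<And>z. z \<in> V \<Longrightarrow> q' z \<noteq> 0 \<and> g z = p' z / q' z"
    using assms(2) unfolding regulous_def by blast
  obtain a r where r: "is_poly2 r" "r a \<noteq> 0" "\<And>w. r w \<noteq> 0 \<Longrightarrow> w \<in> U"
    using zariski_openE[OF f(3)] f(4) by blast
  obtain b s where s: "is_poly2 s" "s b \<noteq> 0" "\<And>w. s w \<noteq> 0 \<Longrightarrow> w \<in> V"
    using zariski_openE[OF g(3)] g(4) by blast
  obtain z where z: "r z \<noteq> 0" "s z \<noteq> 0" using is_poly2_common_nonzero[OF r(1,2) s(1,2)] .
  have "zariski_open {w. r w * s w \<noteq> 0}"
    by (intro zariski_open_nonzero is_poly2_mult r s)
  moreover have "z \<in> {w. r w * s w \<noteq> 0}" using z by simp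
  moreover have "q w * q' w \<noteq> 0 \<and> f w * g w = (p w * p' w) / (q w * q' w)"
    if "w \<in> {w. r w * s w \<noteq> 0}" for w
    using that f(5)[OF r(3), of w] g(5)[OF s(3), of w] by simp
  ultimately show ?thesis
    unfolding regulous_def using assms(3) is_poly2_mult[OF f(1) g(1)] is_poly2_mult[OF f(2) g(2)]
    by blast
qed

lemma regular_at_imp_rat_regular_at: "regular_at f z \<Longrightarrow> rat_regular_at f z"
  unfolding regular_at_def rat_regular_at_def by blast

theorem theorem3p7:
  fixes k :: nat and f h :: "real \<times> real \<Rightarrow> real"
  assumes "regulous_1 k f"
    and "regulous_1 (Suc k) h"
    and "pol f \<subseteq> {z. h z = 0}"
  shows "regulous_1 (Suc k) (\<lambda>z. h z * f z)"
proof -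
  obtain S where S: "regular_after_blowup f S" using assms(1) unfolding regulous_1_def by blast
  obtain T where T: "regular_after_blowup h T" using assms(2) unfolding regulous_1_def by blast
  have reg: "regulous k f" "regulous (Suc k) h"
    using assms(1,2) unfolding regulous_1_def by auto
  then have C: "Ck k f" "Ck (Suc k) h" unfolding regulous_def by auto
  \<comment> \<open>Outside the centres \<open>f\<close> is regular, so its poles are among them; in
    particular they are finite in number.\<close>
  have sub: "pol f \<subseteq> S"
    using S regular_at_imp_rat_regular_at
    unfolding regular_after_blowup_def pol_def dom_reg_def by blast
  have "Ck (Suc k) (\<lambda>z. h z * f z)"
  \<comment> \<open>The exceptional set is taken to be \<open>pol f\<close> and not
    \<open>S\<close>, because \<open>h\<close> is known to vanish only at the poles. At the other
    centres, continuity makes \<open>f\<close> agree with its regular rational function.\<close>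
  proof (rule Ck_Suc_mult[OF _ _ _ C])
    show "finite (pol f)"
      using sub S finite_subset unfolding regular_after_blowup_def by blast
    show "rational_near f z" if "z \<notin> pol f" for z
      using that rat_regular_at_imp_rational_near Ck_continuous[OF C(1)]
      unfolding pol_def dom_reg_def by blast
    show "blowup_rational f a" if "a \<in> pol f" for a
      using that sub S regular_after_blowup_imp_blowup_rational by blast
    show "h a = 0" if "a \<in> pol f" for a using that assms(3) by blast
  qed
  then have "regulous (Suc k) (\<lambda>z. h z * f z)" using regulous_multI reg by blast
  then show ?thesis
    using regular_after_blowup_mult[OF T S] unfolding regulous_1_def by blast
qed

end
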